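(* Let $n\ge 2$ and $1\le k\le n-1$. The adjacency spectrum of the enhanced hypercube $Q_{n,k}$ is \[\mathrm{Spec}_A(Q_{n,k})=\{n+1,\ [n-1]^{k-1},\ [n-2t-1]^{\gamma_t}\ (t=1,\dots,n-1),\ [-n-1]^{\gamma_n}\},\] where $\gamma_t=\sum_{j=0}^{n}{n-k+2\choose 2j}{k-1\choose t+1-2j}$ for $1\le t\le n-1$ and $\gamma_n=\sum_{j=1}^{n}{n-k+1\choose 2j-1}{k-1\choose n-2j+1}$.
   Context: For $n\ge 2$ and $1\le k\le n-1$, the enhanced hypercube $Q_{n,k}$ is the simple graph whose vertices are the binary strings $x_1x_2\cdots x_n$ ($x_i\in\{0,1\}$), where $X=x_1\cdots x_n$ and $Y$ are adjacent iff either $Y$ is obtained from $X$ by complementing exactly one coordinate ($1\le i\le n$), or $Y=x_1\cdots x_{k-1}\overline{x_k}\,\overline{x_{k+1}}\cdots\overline{x_n}$. The adjacency spectrum is the multiset of eigenvalues of the adjacency matrix; $[\lambda]^m$ denotes eigenvalue $\lambda$ with multiplicity $m$ (multiplicity $0$ meaning $\lambda$ does not occur). Binomial coefficients ${a\choose b}$ are $0$ when $b<0$ or $b>a$. *)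

theory Defs
  imports
    "Jordan_Normal_Form.Char_Poly"
    "Graph_Theory.Pair_Digraph"
    "HOL-Library.Multiset"
begin

text \<open>
  Simple graphs are the loop-free symmetric digraphs without parallel arcs of
  Graph_Theory (locale \<^locale>\<open>pair_graph\<close>): the edge between \<open>u\<close> and \<open>v\<close> is the pair of arcs
  \<open>(u, v)\<close> and \<open>(v, u)\<close>.

  A binary string \<open>x\<^sub>1 x\<^sub>2 \<dots> x\<^sub>n\<close> is a Boolean list of length \<open>n\<close>. List positions are
  counted from 0, so the coordinate \<open>x\<^sub>i\<close> is \<open>x ! (i - 1)\<close>.
\<close>

definition flip_coord :: "nat \<Rightarrow> bool list \<Rightarrow> bool list" where
  "flip_coord i x = x[i - 1 := \<not> x ! (i - 1)]"

definition flip_from :: "nat \<Rightarrow> bool list \<Rightarrow> bool list" where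
  "flip_from k x = take (k - 1) x @ map Not (drop (k - 1) x)"

definition enhanced_hypercube :: "nat \<Rightarrow> nat \<Rightarrow> bool list pair_pre_digraph" where
  "enhanced_hypercube n k =
     \<lparr> pverts = {x. length x = n},
       parcs = {(x, y). length x = n \<and>
                  ((\<exists>i\<in>{1..n}. y = flip_coord i x) \<or> y = flip_from k x)} \<rparr>"

lemma flip_coord_flip_coord: "flip_coord i (flip_coord i x) = x"
  by (cases "i - 1 < length x") (simp_all add: flip_coord_def list_update_beyond)

lemma flip_from_flip_from: "flip_from k (flip_from k x) = x"
  by (cases "k - 1 \<le> length x") (simp_all add: flip_from_def comp_def)

lemma flip_coord_neq:
  assumes "i \<in> {1..length x}"
  shows "flip_coord i x \<noteq> x"
proof -
  have "flip_coord i x ! (i - 1) = (\<not> x ! (i - 1))"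
    unfolding flip_coord_def using assms by (intro nth_list_update_eq) auto
  then show ?thesis by metis
qed

lemma flip_from_neq:
  assumes "1 \<le> k" "k \<le> length x"
  shows "flip_from k x \<noteq> x"
proof -
  have "flip_from k x ! (k - 1) = (\<not> x ! (k - 1))"
    unfolding flip_from_def using assms by (simp add: nth_append)
  then show ?thesis by metis
qed

lemma pair_graph_enhanced_hypercube:
  assumes "1 \<le> k" "k \<le> n"
  shows "pair_graph (enhanced_hypercube n k)"
proof -
  have fin: "finite {x :: bool list. length x = n}"
    using finite_lists_length_eq[of "UNIV :: bool set" n] by simp
  have sub: "parcs (enhanced_hypercube n k) \<subseteq> {x. length x = n} \<times> {x. length x = n}"
    by (auto simp: enhanced_hypercube_def flip_coord_def flip_from_def)
  have fin_arcs: "finite (parcs (enhanced_hypercube n k))"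
    using finite_subset[OF sub] fin by blast
  have verts: "pverts (enhanced_hypercube n k) = {x. length x = n}"
    by (simp add: enhanced_hypercube_def)
  have sym_arcs: "sym (parcs (enhanced_hypercube n k))"
  proof (rule symI)
    fix x y assume a: "(x, y) \<in> parcs (enhanced_hypercube n k)"
    then have "length y = n" using sub by auto
    moreover have "(\<exists>i\<in>{1..n}. y = flip_coord i x) \<or> y = flip_from k x"
      using a by (simp add: enhanced_hypercube_def)
    then have "(\<exists>i\<in>{1..n}. x = flip_coord i y) \<or> x = flip_from k y"
      by (metis flip_coord_flip_coord flip_from_flip_from)
    ultimately show "(y, x) \<in> parcs (enhanced_hypercube n k)"
      by (simp add: enhanced_hypercube_def)
  qed
  have no_loops: "(x, x) \<notin> parcs (enhanced_hypercube n k)" for x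
    using assms flip_coord_neq[of _ x, symmetric] flip_from_neq[of k x, symmetric]
    by (auto simp: enhanced_hypercube_def)
  show ?thesis
  proof unfold_locales
    fix e assume e: "e \<in> parcs (enhanced_hypercube n k)"
    show "fst e \<in> pverts (enhanced_hypercube n k)" "snd e \<in> pverts (enhanced_hypercube n k)"
      using e sub verts by auto
    show "fst e \<noteq> snd e" using e no_loops by (metis prod.collapse)
  qed (use fin fin_arcs sym_arcs verts in \<open>simp_all add: symmetric_def\<close>)
qed

text \<open>
  The adjacency matrix with rows and columns indexed by an enumeration \<open>vs\<close> of the vertices.
  It is taken over the complex numbers, so that the roots of its characteristic polynomial,
  counted with multiplicity, account for all of its eigenvalues.
\<close>

definition adjacency_matrix :: "'a pair_pre_digraph \<Rightarrow> 'a list \<Rightarrow> complex mat" where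
  "adjacency_matrix G vs =
     mat (length vs) (length vs) (\<lambda>(i, j). if (vs ! i, vs ! j) \<in> parcs G then 1 else 0)"

definition adjacency_spectrum :: "'a pair_pre_digraph \<Rightarrow> 'a list \<Rightarrow> complex multiset" where
  "adjacency_spectrum G vs = proots (char_poly (adjacency_matrix G vs))"

text \<open>
  Binomial coefficients with integer arguments, equal to 0 when \<open>b < 0\<close> or \<open>b > a\<close>. Truncated
  subtraction on the natural numbers would instead turn a negative lower argument into 0 and
  the coefficient into 1.
\<close>

definition ibinom :: "int \<Rightarrow> int \<Rightarrow> nat" where
  "ibinom a b = (if b < 0 \<or> b > a then 0 else nat a choose nat b)"

definition spec_mult :: "nat \<Rightarrow> nat \<Rightarrow> nat \<Rightarrow> nat" where
  "spec_mult n k t =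
     (\<Sum>j = 0..n. ibinom (int n - int k + 2) (2 * int j) *
                 ibinom (int k - 1) (int t + 1 - 2 * int j))"

definition spec_mult_last :: "nat \<Rightarrow> nat \<Rightarrow> nat" where
  "spec_mult_last n k =
     (\<Sum>j = 1..n. ibinom (int n - int k + 1) (2 * int j - 1) *
                 ibinom (int k - 1) (int n - 2 * int j + 1))"

end

theory Submission
  imports Defs
begin

text \<open>
  The graph is the Cayley graph of the elementary abelian 2-group of binary strings whose
  generators are the unit vectors and the indicator of the last \<open>n - k + 1\<close> coordinates. Hence the
  characters of the group form an eigenbasis, and the character indexed by a string with \<open>a\<close> ones
  among its first \<open>k - 1\<close> entries and \<open>b\<close> ones among the others has eigenvalue
  \<open>n - 2 (a + b) + (-1)\<^sup>b\<close>. This equals \<open>n + 1 - 2 s\<close> with \<open>s = a + b + (b mod 2)\<close>, and adding a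
  parity bit to the second block identifies the strings with a given \<open>s\<close> with strings of weight
  \<open>s\<close> and length \<open>n + 1\<close> whose last \<open>n - k + 2\<close> entries have even weight. Summing over
  that even weight \<open>2 j\<close> gives the multiplicities.
\<close>

section \<open>Sums over binary strings\<close>

definition cube :: "nat \<Rightarrow> bool list set" where
  "cube n = {x. length x = n}"

abbreviation weight :: "bool list \<Rightarrow> nat" where
  "weight x \<equiv> count_list x True"

lemma mem_cube [simp]: "x \<in> cube n \<longleftrightarrow> length x = n"
  by (simp add: cube_def)

lemma finite_cube [simp]: "finite (cube n)"
  using finite_lists_length_eq[of "UNIV :: bool set" n] by (simp add: cube_def)

lemma cube_0: "cube 0 = {[]}"
  by (auto simp: cube_def)

lemma sum_cube_Suc: "sum f (cube (Suc n)) = (\<Sum>x\<in>cube n. f (True # x) + f (False # x))"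
proof -
  have "cube (Suc n) = (#) True ` cube n \<union> (#) False ` cube n"
    by (auto simp: cube_def length_Suc_conv image_iff)
  moreover have "(#) True ` cube n \<inter> (#) False ` cube n = {}"
    by auto
  ultimately show ?thesis
    by (simp add: sum.union_disjoint sum.reindex sum.distrib)
qed

lemma sum_cube_add: "sum f (cube (p + q)) = (\<Sum>y\<in>cube p. \<Sum>z\<in>cube q. f (y @ z))"
proof (induction p arbitrary: f)
  case 0
  then show ?case by (simp add: cube_0)
next
  case (Suc p)
  have "sum f (cube (Suc p + q)) = (\<Sum>x\<in>cube (p + q). f (True # x) + f (False # x))"
    by (simp add: sum_cube_Suc)
  also have "\<dots> = (\<Sum>y\<in>cube p. \<Sum>z\<in>cube q. f (True # y @ z) + f (False # y @ z))"
    using Suc.IH[of "\<lambda>x. f (True # x) + f (False # x)"] by simp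
  finally show ?case
    by (simp add: sum_cube_Suc sum.distrib)
qed

lemma sum_cube_weight_eq: "(\<Sum>x\<in>cube n. of_bool (weight x = a)) = n choose a"
proof (induction n arbitrary: a)
  case 0
  then show ?case by (cases a) (simp_all add: cube_0)
next
  case (Suc n)
  show ?case
  proof (cases a)
    case 0
    then show ?thesis using Suc.IH[of 0] by (simp add: sum_cube_Suc)
  next
    case a: (Suc b)
    then show ?thesis using Suc.IH[of b] Suc.IH[of a]
      by (simp add: sum_cube_Suc sum.distrib)
  qed
qed

text \<open>The binomials beyond \<open>n\<close> vanish, so any \<open>N\<close> from
  \<open>n\<close> on works; this freedom allows an odd upper end of the form
  \<open>2 * N + 1\<close> in the parity argument.\<close>

lemma sum_cube_weight:
  fixes g :: "nat \<Rightarrow> nat"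
  assumes "n \<le> N"
  shows "(\<Sum>x\<in>cube n. g (weight x)) = (\<Sum>b\<le>N. (n choose b) * g b)"
proof -
  have "g (weight x) = (\<Sum>b\<le>N. of_bool (weight x = b) * g b)" if "x \<in> cube n" for x
  proof -
    have "weight x \<le> N" using count_le_length[of x True] that assms by simp
    then show ?thesis by (simp add: of_bool_def if_distrib[of "\<lambda>c. c * _"] cong: if_cong)
  qed
  then have "(\<Sum>x\<in>cube n. g (weight x)) = (\<Sum>x\<in>cube n. \<Sum>b\<le>N. of_bool (weight x = b) * g b)"
    by (rule sum.cong[OF refl])
  also have "\<dots> = (\<Sum>b\<le>N. (\<Sum>x\<in>cube n. of_bool (weight x = b)) * g b)"
    by (subst sum.swap) (simp only: sum_distrib_right)
  finally show ?thesis by (simp only: sum_cube_weight_eq)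
qed

lemma sum_atMost_even:
  fixes f :: "nat \<Rightarrow> nat"
  shows "(\<Sum>b\<le>2 * N + 1. of_bool (even b) * f b) = (\<Sum>j = 0..N. f (2 * j))"
  by (induction N) simp_all

text \<open>Each string is completed to one of even weight by prepending its parity bit.\<close>

lemma sum_cube_weight_parity:
  fixes g :: "nat \<Rightarrow> nat"
  assumes "n \<le> 2 * N"
  shows "(\<Sum>z\<in>cube n. g (weight z + weight z mod 2)) = (\<Sum>j = 0..N. (Suc n choose (2 * j)) * g (2 * j))"
proof -
  have "(\<Sum>z\<in>cube n. g (weight z + weight z mod 2))
      = (\<Sum>z\<in>cube (Suc n). of_bool (even (weight z)) * g (weight z))"
    \<comment> \<open>Exactly one of \<open>True # z\<close> and \<open>False # z\<close> has even
      weight, namely \<open>weight z + weight z mod 2\<close>.\<close>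
    unfolding sum_cube_Suc by (intro sum.cong) (auto simp: odd_iff_mod_2_eq_one)
  also have "\<dots> = (\<Sum>b\<le>2 * N + 1. (Suc n choose b) * (of_bool (even b) * g b))"
    using assms by (intro sum_cube_weight) simp
  also have "\<dots> = (\<Sum>b\<le>2 * N + 1. of_bool (even b) * ((Suc n choose b) * g b))"
    by (intro sum.cong) auto
  finally show ?thesis by (simp only: sum_atMost_even)
qed

section \<open>Characters\<close>

text \<open>For strings of equal length this is (-1)^(u . v), an entry of the Sylvester-Hadamard
  matrix. That matrix is symmetric and, up to a scalar, its own inverse.\<close>

fun character :: "bool list \<Rightarrow> bool list \<Rightarrow> complex" where
  "character (a # u) (b # v) = (if a \<and> b then -1 else 1) * character u v"
| "character _ _ = 1"

text \<open>The sum factors over coordinates: a coordinate contributes 2 if the two bits agree and 0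
  otherwise. With \<open>v\<close> in the inner positions, it is an entry of the square of the
  character table.\<close>

lemma character_orthogonal:
  assumes "length u = n" "length w = n"
  shows "(\<Sum>v\<in>cube n. character u v * character v w) = (if u = w then 2 ^ n else 0)"
  using assms
proof (induction n arbitrary: u w)
  case 0
  then show ?case by (simp add: cube_0)
next
  case (Suc n)
  then obtain a u' b w' where uw: "u = a # u'" "w = b # w'" "length u' = n" "length w' = n"
    by (metis length_Suc_conv)
  have "(\<Sum>v\<in>cube (Suc n). character u v * character v w)
      = (\<Sum>v\<in>cube n. (1 + (if a then -1 else 1) * (if b then -1 else 1)) * (character u' v * character v w'))"
    unfolding sum_cube_Suc uw by (intro sum.cong) (auto simp: algebra_simps)
  also have "\<dots> = (1 + (if a then -1 else 1) * (if b then -1 else 1)) * (if u' = w' then 2 ^ n else 0)"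
    unfolding sum_distrib_left[symmetric] Suc.IH[OF uw(3,4)] ..
  finally show ?case using uw by auto
qed

lemma character_list_update:
  assumes "i < length u" "length w = length u"
  shows "character (u[i := \<not> u ! i]) w = (if w ! i then -1 else 1) * character u w"
  using assms
proof (induction u w arbitrary: i rule: character.induct)
  case (1 a u b v)
  then show ?case by (cases i) auto
qed auto

lemma character_map_Not:
  "length u = length w \<Longrightarrow> character (map Not u) w = (-1) ^ weight w * character u w"
  by (induction u w rule: list_induct2) auto

lemma character_flip_suffix:
  "length u = length w \<Longrightarrow>
   character (take j u @ map Not (drop j u)) w = (-1) ^ weight (drop j w) * character u w"
proof (induction u w arbitrary: j rule: list_induct2)
  case (Cons a u b w)
  then show ?case
    by (cases j) (auto simp: character_map_Not)
qed simp

lemma sum_signs: "(\<Sum>i<length w. if w ! i then -1 else 1 :: complex) = of_nat (length w) - 2 * of_nat (weight w)"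
  by (induction w) (simp_all add: sum.lessThan_Suc_shift del: sum.lessThan_Suc)

section \<open>Diagonalisation\<close>

lemma proots_char_poly_mat_diag:
  fixes f :: "nat \<Rightarrow> complex"
  shows "proots (char_poly (mat_diag N f)) = mset (map f [0..<N])"
proof -
  have "diag_mat (mat_diag N f) = map f [0..<N]"
    by (simp add: diag_mat_def mat_diag_def)
  moreover have "upper_triangular (mat_diag N f)"
    by (auto simp: upper_triangular_def mat_diag_def)
  ultimately have "char_poly (mat_diag N f) = (\<Prod>a\<leftarrow>map f [0..<N]. [:- a, 1:])"
    using char_poly_upper_triangular[OF mat_diag_dim] by metis
  moreover have "proots (\<Prod>a\<leftarrow>as. [:- a, 1:]) = mset as" for as :: "complex list"
  proof (induction as)
    case (Cons a as)
    have "(\<Prod>a\<leftarrow>as. [:- a, 1:]) \<noteq> 0"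
      by (auto simp: prod_list_zero_iff)
    then have "proots (\<Prod>a\<leftarrow>a # as. [:- a, 1:]) = proots [:- a, 1:] + mset as"
      using Cons.IH proots_mult[of "[:- a, 1:]" "\<Prod>a\<leftarrow>as. [:- a, 1:]"] by simp
    then show ?case by simp
  qed simp
  ultimately show ?thesis by (simp only:)
qed

text \<open>
  The values \<open>h i j\<close> are the entries of a matrix \<open>H\<close> with \<open>H\<^sup>2 = c\<close>, so that \<open>A H = H D\<close> makes \<open>A\<close>
  similar to the diagonal matrix \<open>D\<close> of the values \<open>f j\<close>.
\<close>

lemma proots_char_poly_involutive:
  fixes A :: "complex mat" and h :: "nat \<Rightarrow> nat \<Rightarrow> complex"
  assumes A: "A \<in> carrier_mat N N" and "c \<noteq> 0"
    and inv: "\<And>i j. i < N \<Longrightarrow> j < N \<Longrightarrow> (\<Sum>l<N. h i l * h l j) = (if i = j then c else 0)"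
    and eig: "\<And>i j. i < N \<Longrightarrow> j < N \<Longrightarrow> (\<Sum>l<N. A $$ (i, l) * h l j) = h i j * f j"
  shows "proots (char_poly A) = mset (map f [0..<N])"
proof -
  define H where "H = mat N N (\<lambda>(i, j). h i j)"
  define Q where "Q = (1 / c) \<cdot>\<^sub>m H"
  have H: "H \<in> carrier_mat N N" and Q: "Q \<in> carrier_mat N N"
    by (simp_all add: H_def Q_def)
  have "H * H = c \<cdot>\<^sub>m 1\<^sub>m N"
    by (rule eq_matI) (auto simp: H_def scalar_prod_def inv lessThan_atLeast0[symmetric])
  then have HQ: "H * Q = 1\<^sub>m N"
    unfolding Q_def using \<open>c \<noteq> 0\<close> H by (auto simp: mult_smult_distrib[OF H H] intro!: eq_matI)
  then have QH: "Q * H = 1\<^sub>m N"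
    using mat_mult_left_right_inverse[OF H Q] by simp
  have "A * H = H * mat_diag N f"
    unfolding mat_diag_mult_right[OF H] using A
    by (intro eq_matI) (auto simp: H_def scalar_prod_def eig lessThan_atLeast0[symmetric])
  then have "H * mat_diag N f * Q = A * (H * Q)"
    using A H Q by (metis assoc_mult_mat)
  then have "A = H * mat_diag N f * Q"
    using A by (simp add: HQ)
  then have "similar_mat A (mat_diag N f)"
    using A H Q HQ QH by (intro similar_matI[of _ _ H Q N]) auto
  then show ?thesis
    using proots_char_poly_mat_diag by (simp add: char_poly_similar)
qed

section \<open>The enhanced hypercube\<close>

text \<open>The eigenvalue at \<open>w\<close> is \<open>n + 1 - 2 * level k w\<close>.\<close>

definition level :: "nat \<Rightarrow> bool list \<Rightarrow> nat" where
  "level k w = weight (take (k - 1) w) + (weight (drop (k - 1) w) + weight (drop (k - 1) w) mod 2)"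

lemma weight_take_drop: "weight w = weight (take j w) + weight (drop j w)"
  by (metis append_take_drop_id count_list_append)

text \<open>The bound is \<open>Suc n\<close> because the parity bit adds one to a full second block
  of odd length.\<close>

lemma level_le:
  assumes "length w = n" "k - 1 \<le> n"
  shows "level k w \<le> Suc n"
proof -
  have "weight (take (k - 1) w) \<le> k - 1" "weight (drop (k - 1) w) \<le> n - (k - 1)"
    using assms count_le_length[of "take (k - 1) w" True] count_le_length[of "drop (k - 1) w" True]
    by simp_all
  moreover have "weight (drop (k - 1) w) mod 2 \<le> 1" by simp
  ultimately show ?thesis unfolding level_def using assms by linarith
qed

text \<open>The \<open>n + 1\<close> generators lead to distinct neighbours. A neighbour reached
  twice would count once on the left and twice on the right.\<close>

lemma neighbour_sum:
  fixes f :: "bool list \<Rightarrow> complex"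
  assumes "1 \<le> k" "k \<le> n - 1" "length x = n"
  shows "(\<Sum>y\<in>cube n. (if (x, y) \<in> parcs (enhanced_hypercube n k) then 1 else 0) * f y)
       = (\<Sum>i<n. f (x[i := \<not> x ! i])) + f (flip_from k x)"
proof -
  let ?F = "(\<lambda>i. x[i := \<not> x ! i]) ` {..<n}"
  have flip: "(\<exists>i\<in>{1..n}. y = flip_coord i x) \<longleftrightarrow> y \<in> ?F" for y
  proof
    assume "\<exists>i\<in>{1..n}. y = flip_coord i x"
    then obtain i where "i \<in> {1..n}" "y = x[i - 1 := \<not> x ! (i - 1)]"
      by (auto simp: flip_coord_def)
    then show "y \<in> ?F" by (intro image_eqI[of _ _ "i - 1"]) auto
  next
    assume "y \<in> ?F"
    then obtain i where "i < n" "y = x[i := \<not> x ! i]" by auto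
    then show "\<exists>i\<in>{1..n}. y = flip_coord i x"
      by (intro bexI[of _ "Suc i"]) (auto simp: flip_coord_def)
  qed
  have inj: "inj_on (\<lambda>i. x[i := \<not> x ! i]) {..<n}"
  proof (rule inj_onI)
    fix i j assume ij: "i \<in> {..<n}" "j \<in> {..<n}" "x[i := \<not> x ! i] = x[j := \<not> x ! j]"
    then have "x[i := \<not> x ! i] ! i = x[j := \<not> x ! j] ! i" by simp
    then show "i = j" using ij(1,2) assms(3) by (metis lessThan_iff nth_list_update_eq nth_list_update_neq)
  qed
  have "flip_from k x \<notin> ?F"
  proof
    assume "flip_from k x \<in> ?F"
    then obtain i where i: "flip_from k x = x[i := \<not> x ! i]" by auto
    have flipped: "flip_from k x ! l = (\<not> x ! l)" if "k - 1 \<le> l" "l < n" for l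
      using that assms by (simp add: flip_from_def nth_append)
    \<comment> \<open>\<open>flip_from k\<close> changes every position from \<open>k - 1\<close>
      on, a single flip only position \<open>i\<close>. Since k <= n - 1, both \<open>k - 1\<close>
      and \<open>k\<close> are such positions.\<close>
    have "i = l" if "k - 1 \<le> l" "l < n" for l
      using flipped[OF that] i by (cases "i = l") simp_all
    then have "i = k - 1" "i = k" using assms by simp_all
    then show False using assms by simp
  qed
  moreover have "length (flip_from k x) = n"
    using assms by (simp add: flip_from_def)
  moreover have "{y \<in> cube n. (x, y) \<in> parcs (enhanced_hypercube n k)} = insert (flip_from k x) ?F"
  proof -
    have "(x, y) \<in> parcs (enhanced_hypercube n k) \<longleftrightarrow> y \<in> insert (flip_from k x) ?F" for y
      unfolding insert_iff flip[symmetric] using assms by (auto simp: enhanced_hypercube_def)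
    moreover have "insert (flip_from k x) ?F \<subseteq> cube n"
      using assms \<open>length (flip_from k x) = n\<close> by auto
    ultimately show ?thesis by blast
  qed
  moreover have "(\<Sum>y\<in>cube n. (if (x, y) \<in> parcs (enhanced_hypercube n k) then 1 else 0) * f y)
      = sum f {y \<in> cube n. (x, y) \<in> parcs (enhanced_hypercube n k)}"
    by (simp add: sum.If_cases if_distrib[of "\<lambda>c. c * _"] Int_def cong: if_cong)
  ultimately show ?thesis
    using inj by (simp add: sum.reindex add.commute)
qed

text \<open>Each generator multiplies the character by a sign depending only on \<open>w\<close>.
  The unit vectors contribute \<open>n - 2 * weight w\<close> in total, the suffix flip the parity
  sign of the second block.\<close>

lemma character_eigenvector:
  assumes "1 \<le> k" "k \<le> n - 1" "length x = n" "length w = n"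
  shows "(\<Sum>y\<in>cube n. (if (x, y) \<in> parcs (enhanced_hypercube n k) then 1 else 0) * character y w)
       = character x w * (of_nat n + 1 - 2 * of_nat (level k w))"
proof -
  let ?d = "weight (drop (k - 1) w)"
  \<comment> \<open>In this form the sign is absorbed as the parity bit of
    \<open>level\<close>.\<close>
  have sign: "(-1) ^ ?d = (1 - 2 * of_nat (?d mod 2) :: complex)"
    by (cases "even ?d") (simp_all add: odd_iff_mod_2_eq_one)
  have "(\<Sum>i<n. character (x[i := \<not> x ! i]) w) = (\<Sum>i<n. (if w ! i then -1 else 1) * character x w)"
    using assms by (intro sum.cong) (simp_all add: character_list_update)
  also have "\<dots> = (of_nat n - 2 * of_nat (weight w)) * character x w"
    using sum_signs[of w] assms by (simp add: sum_distrib_right[symmetric])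
  finally have "(\<Sum>y\<in>cube n. (if (x, y) \<in> parcs (enhanced_hypercube n k) then 1 else 0) * character y w)
      = (of_nat n - 2 * of_nat (weight w)) * character x w + (-1) ^ ?d * character x w"
    using assms by (simp only: neighbour_sum flip_from_def character_flip_suffix)
  also have "\<dots> = character x w * (of_nat n - 2 * of_nat (weight w) + (1 - 2 * of_nat (?d mod 2)))"
    unfolding sign by (simp only: algebra_simps)
  also have "\<dots> = character x w * (of_nat n + 1 - 2 * of_nat (level k w))"
    unfolding level_def weight_take_drop[of w "k - 1"] by (simp add: algebra_simps)
  finally show ?thesis .
qed

lemma adjacency_spectrum_eq_image:
  assumes k: "1 \<le> k" "k \<le> n - 1"
    and vs: "distinct vs" "set vs = pverts (enhanced_hypercube n k)"
  shows "adjacency_spectrum (enhanced_hypercube n k) vs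
       = image_mset (\<lambda>w. of_nat n + 1 - 2 * of_nat (level k w)) (mset_set (cube n))"
proof -
  let ?lam = "\<lambda>w. of_nat n + 1 - 2 * of_nat (level k w) :: complex"
  let ?A = "adjacency_matrix (enhanced_hypercube n k) vs"
  have set_vs: "set vs = cube n"
    using vs(2) by (simp add: enhanced_hypercube_def cube_def)
  have len: "length (vs ! i) = n" if "i < length vs" for i
    using nth_mem[OF that] set_vs by simp
  have "bij_betw ((!) vs) {..<length vs} (cube n)"
    using bij_betw_nth[OF vs(1) refl set_vs[symmetric]] .
  then have sum_vs: "(\<Sum>l<length vs. g (vs ! l)) = sum g (cube n)" for g :: "bool list \<Rightarrow> complex"
    by (rule sum.reindex_bij_betw)
  have "proots (char_poly ?A) = mset (map (\<lambda>j. ?lam (vs ! j)) [0..<length vs])"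
  \<comment> \<open>Rows and columns of the character table use the same enumeration
    \<open>vs\<close>, so its square makes sense; orthogonality supplies the scalar
    \<open>2 ^ n\<close>.\<close>
  proof (rule proots_char_poly_involutive[where c = "2 ^ n" and h = "\<lambda>i j. character (vs ! i) (vs ! j)"])
    show "?A \<in> carrier_mat (length vs) (length vs)"
      by (simp add: adjacency_matrix_def)
    fix i j assume ij: "i < length vs" "j < length vs"
    show "(\<Sum>l<length vs. character (vs ! i) (vs ! l) * character (vs ! l) (vs ! j)) = (if i = j then 2 ^ n else 0)"
      using sum_vs[of "\<lambda>v. character (vs ! i) v * character v (vs ! j)"]
        character_orthogonal[OF len len] ij vs(1) by (simp add: nth_eq_iff_index_eq)
    have "(\<Sum>l<length vs. ?A $$ (i, l) * character (vs ! l) (vs ! j))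
        = (\<Sum>l<length vs. (if (vs ! i, vs ! l) \<in> parcs (enhanced_hypercube n k) then 1 else 0)
            * character (vs ! l) (vs ! j))"
      using ij by (intro sum.cong) (simp_all add: adjacency_matrix_def)
    then show "(\<Sum>l<length vs. ?A $$ (i, l) * character (vs ! l) (vs ! j))
        = character (vs ! i) (vs ! j) * ?lam (vs ! j)"
      using sum_vs[of "\<lambda>y. (if (vs ! i, y) \<in> parcs (enhanced_hypercube n k) then 1 else 0)
          * character y (vs ! j)"] character_eigenvector[OF k len len] ij by simp
  qed simp
  also have "map (\<lambda>j. ?lam (vs ! j)) [0..<length vs] = map ?lam vs"
    by (rule nth_equalityI) simp_all
  finally show ?thesis
    by (simp add: adjacency_spectrum_def mset_set_set[OF vs(1), symmetric] set_vs)
qed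

section \<open>Multiplicities\<close>

text \<open>Grouping by \<open>s x\<close> turns a list of eigenvalues into multiplicities.
  \<open>B\<close> may exceed the image, as empty fibres add nothing.\<close>

lemma image_mset_fibres:
  assumes "finite A" "finite B" "s ` A \<subseteq> B"
  shows "image_mset (\<lambda>x. g (s x)) (mset_set A) = (\<Sum>r\<in>B. replicate_mset (card {x \<in> A. s x = r}) (g r))"
  using assms(1,3)
proof (induction A)
  case (insert a A)
  have "card {x \<in> insert a A. s x = r} = card {x \<in> A. s x = r} + of_bool (r = s a)" for r
  proof (cases "r = s a")
    case True
    then have "{x \<in> insert a A. s x = r} = insert a {x \<in> A. s x = r}" by auto
    with insert True show ?thesis by simp
  next
    case False
    then have "{x \<in> insert a A. s x = r} = {x \<in> A. s x = r}" by auto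
    with False show ?thesis by simp
  qed
  moreover have "replicate_mset (p + q) y = replicate_mset p y + replicate_mset q y" for p q and y :: 'c
    by (induction p) auto
  moreover have "(\<Sum>r\<in>B. replicate_mset (of_bool (r = s a)) (g r)) = {#g (s a)#}"
  proof -
    have "(\<Sum>r\<in>B. replicate_mset (of_bool (r = s a)) (g r)) = (\<Sum>r\<in>B. if r = s a then {#g r#} else {#})"
      by (intro sum.cong) auto
    then show ?thesis using insert.prems assms(2) by simp
  qed
  ultimately show ?case using insert by (simp add: sum.distrib)
qed simp

lemma ibinom_of_nat: "ibinom (int a) (int b) = a choose b"
  by (auto simp: ibinom_def binomial_eq_0)

lemma ibinom_neg: "b < 0 \<Longrightarrow> ibinom a b = 0"
  by (simp add: ibinom_def)

text \<open>The guard keeps the terms with negative lower index zero; truncated subtraction would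
  make that binomial 1.\<close>

lemma spec_mult_choose:
  assumes "1 \<le> k" "k \<le> n"
  shows "spec_mult n k t
       = (\<Sum>j = 0..n. ((n - k + 2) choose (2 * j)) * (if 2 * j \<le> t + 1 then (k - 1) choose (t + 1 - 2 * j) else 0))"
  unfolding spec_mult_def
proof (intro sum.cong arg_cong2[where f = "(*)"] refl)
  fix j
  have *: "int n - int k + 2 = int (n - k + 2)" "2 * int j = int (2 * j)" "int k - 1 = int (k - 1)"
    using assms by simp_all
  show "ibinom (int n - int k + 2) (2 * int j) = (n - k + 2) choose (2 * j)"
    by (simp only: * ibinom_of_nat)
  show "ibinom (int k - 1) (int t + 1 - 2 * int j)
      = (if 2 * j \<le> t + 1 then (k - 1) choose (t + 1 - 2 * j) else 0)"
  proof (cases "2 * j \<le> t + 1")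
    case True
    then have "int t + 1 - 2 * int j = int (t + 1 - 2 * j)" by simp
    with True show ?thesis by (simp only: * ibinom_of_nat if_True)
  qed (simp add: ibinom_neg)
qed

text \<open>If the completed second block, of length \<open>n - k + 2\<close>, has weight
  \<open>2 * j\<close>, then \<open>r - 2 * j\<close> ones remain for the first block. For
  \<open>r = t + 1\<close> this is \<open>spec_mult n k t\<close>.\<close>

lemma card_level:
  assumes "1 \<le> k" "k \<le> n"
  shows "card {w \<in> cube n. level k w = r}
       = (\<Sum>j = 0..n. ((n - k + 2) choose (2 * j)) * (if 2 * j \<le> r then (k - 1) choose (r - 2 * j) else 0))"
proof -
  let ?par = "\<lambda>z. weight z + weight z mod 2"
  have n: "n = (k - 1) + (n - k + 1)" using assms by simp
  have "card {w \<in> cube n. level k w = r} = (\<Sum>w\<in>cube n. of_bool (level k w = r))"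
    by (simp add: Int_def)
  also have "\<dots> = (\<Sum>y\<in>cube (k - 1). \<Sum>z\<in>cube (n - k + 1). of_bool (level k (y @ z) = r))"
    by (subst n) (rule sum_cube_add)
  also have "\<dots> = (\<Sum>y\<in>cube (k - 1). \<Sum>z\<in>cube (n - k + 1). of_bool (weight y + ?par z = r))"
    by (intro sum.cong) (auto simp: level_def)
  \<comment> \<open>With \<open>z\<close> outermost, the inner sum depends on \<open>z\<close> only
    through its completed weight.\<close>
  also have "\<dots> = (\<Sum>z\<in>cube (n - k + 1). \<Sum>y\<in>cube (k - 1). of_bool (weight y + ?par z = r))"
    by (rule sum.swap)
  also have "\<dots> = (\<Sum>j = 0..n. (Suc (n - k + 1) choose (2 * j))
      * (\<Sum>y\<in>cube (k - 1). of_bool (weight y + 2 * j = r)))"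
    using assms by (intro sum_cube_weight_parity) simp
  also have "\<dots> = (\<Sum>j = 0..n. ((n - k + 2) choose (2 * j))
      * (if 2 * j \<le> r then (k - 1) choose (r - 2 * j) else 0))"
  proof (intro sum.cong arg_cong2[where f = "(*)"] refl)
    fix j
    show "(\<Sum>y\<in>cube (k - 1). of_bool (weight y + 2 * j = r))
        = (if 2 * j \<le> r then (k - 1) choose (r - 2 * j) else 0)"
    proof (cases "2 * j \<le> r")
      case True
      then have "(weight y + 2 * j = r) = (weight y = r - 2 * j)" for y by auto
      with True show ?thesis by (simp only: sum_cube_weight_eq if_True)
    qed auto
  qed simp
  finally show ?thesis .
qed

lemma card_level_0:
  assumes "1 \<le> k" "k \<le> n"
  shows "card {w \<in> cube n. level k w = 0} = 1"
proof -
  have "card {w \<in> cube n. level k w = 0} = (\<Sum>j = 0..n. if j = 0 then 1 else 0)"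
    unfolding card_level[OF assms] by (intro sum.cong) auto
  then show ?thesis by simp
qed

lemma spec_mult_0:
  assumes "1 \<le> k" "k \<le> n"
  shows "spec_mult n k 0 = k - 1"
proof -
  have "spec_mult n k 0 = (\<Sum>j = 0..n. if j = 0 then k - 1 else 0)"
    unfolding spec_mult_choose[OF assms] by (intro sum.cong) auto
  then show ?thesis by simp
qed

text \<open>
  When the two weights sum to \<open>n + 1\<close>, both blocks (the second with its parity bit) are full, so the
  parity bit is 1 and Pascal's rule for \<open>n - k + 2\<close> has only one nonzero summand.
\<close>

lemma spec_mult_last_eq:
  assumes "1 \<le> k" "k \<le> n"
  shows "spec_mult_last n k = spec_mult n k n"
proof -
  have "spec_mult n k n = (\<Sum>j = 1..n. ((n - k + 2) choose (2 * j))
      * (if 2 * j \<le> n + 1 then (k - 1) choose (n + 1 - 2 * j) else 0))"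
    unfolding spec_mult_choose[OF assms] using assms
    \<comment> \<open>The term \<open>j = 0\<close> vanishes because n + 1 > k - 1.\<close>
    by (subst sum.atLeast_Suc_atMost) (auto simp: binomial_eq_0)
  also have "\<dots> = spec_mult_last n k"
    unfolding spec_mult_last_def
  proof (intro sum.cong refl)
    fix j assume j: "j \<in> {1..n}"
    have *: "int n - int k + 1 = int (n - k + 1)" "2 * int j - 1 = int (2 * j - 1)" "int k - 1 = int (k - 1)"
      using assms j by auto
    have first: "ibinom (int n - int k + 1) (2 * int j - 1) = (n - k + 1) choose (2 * j - 1)"
      by (simp only: * ibinom_of_nat)
    show "((n - k + 2) choose (2 * j)) * (if 2 * j \<le> n + 1 then (k - 1) choose (n + 1 - 2 * j) else 0)
        = ibinom (int n - int k + 1) (2 * int j - 1) * ibinom (int k - 1) (int n - 2 * int j + 1)"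
    proof (cases "2 * j \<le> n + 1")
      case True
      then have "int n - 2 * int j + 1 = int (n + 1 - 2 * j)" by simp
      then have second: "ibinom (int k - 1) (int n - 2 * int j + 1) = (k - 1) choose (n + 1 - 2 * j)"
        by (simp only: * ibinom_of_nat)
      show ?thesis
      proof (cases "n + 1 - 2 * j \<le> k - 1")
        case le: True
        \<comment> \<open>The case assumption gives 2j >= n - k + 2, which removes one of the two
          Pascal summands.\<close>
        then have "(n - k + 1) choose (2 * j) = 0"
          using assms True by (intro binomial_eq_0) simp
        moreover have "(n - k + 2) choose (2 * j)
            = ((n - k + 1) choose (2 * j - 1)) + ((n - k + 1) choose (2 * j))"
          using j binomial_Suc_Suc[of "n - k + 1" "2 * j - 1"] by simp
        ultimately show ?thesis using True by (simp only: first second if_True add_0_right)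
      next
        case False
        then have "(k - 1) choose (n + 1 - 2 * j) = 0" by (intro binomial_eq_0) simp
        then show ?thesis by (simp only: second) simp
      qed
    qed (simp add: ibinom_neg)
  qed
  finally show ?thesis ..
qed

theorem theorem2:
  fixes n k :: nat and vs :: "bool list list"
  assumes "n \<ge> 2" and "1 \<le> k" and "k \<le> n - 1"
    and "distinct vs" and "set vs = pverts (enhanced_hypercube n k)"
  shows "adjacency_spectrum (enhanced_hypercube n k) vs =
           {# of_nat n + 1 #}
         + replicate_mset (k - 1) (of_nat n - 1)
         + (\<Sum>t = 1..n - 1. replicate_mset (spec_mult n k t) (of_nat n - 2 * of_nat t - 1))
         + replicate_mset (spec_mult_last n k) (- of_nat n - 1)"
proof -
  have k: "1 \<le> k" "k \<le> n" using assms by simp_all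
  define M where "M t = replicate_mset (spec_mult n k t) (of_nat n - 2 * of_nat t - 1 :: complex)" for t
  define F where "F r = replicate_mset (card {w \<in> cube n. level k w = r})
    (of_nat n + 1 - 2 * of_nat r :: complex)" for r
  have F_0: "F 0 = {# of_nat n + 1 #}"
    unfolding F_def card_level_0[OF k] by simp
  \<comment> \<open>The index \<open>t\<close> of the statement is the level minus one.\<close>
  have F_Suc: "F (Suc t) = M t" for t
  proof -
    have "of_nat n + 1 - 2 * of_nat (Suc t) = (of_nat n - 2 * of_nat t - 1 :: complex)" by simp
    then show ?thesis
      unfolding F_def M_def card_level[OF k] spec_mult_choose[OF k] by (simp only: Suc_eq_plus1)
  qed
  have "level k ` cube n \<subseteq> {..Suc n}"
    using level_le k by auto
  then have "adjacency_spectrum (enhanced_hypercube n k) vs = (\<Sum>r\<le>Suc n. F r)"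
    unfolding adjacency_spectrum_eq_image[OF assms(2-5)] F_def
    by (intro image_mset_fibres[where g = "\<lambda>r. of_nat n + 1 - 2 * of_nat r"]) auto
  also have "\<dots> = F 0 + (\<Sum>t\<le>n. M t)"
    unfolding sum.atMost_Suc_shift F_Suc ..
  also have "(\<Sum>t\<le>n. M t) = M 0 + (\<Sum>t = 1..n - 1. M t) + M n"
  proof -
    \<comment> \<open>The two end terms are the ones that the statement lists separately.\<close>
    have "{..n} = insert 0 (insert n {1..n - 1})" using assms(1) by auto
    then show ?thesis using assms(1) by (simp add: ac_simps)
  qed
  also have "M 0 = replicate_mset (k - 1) (of_nat n - 1)"
    unfolding M_def spec_mult_0[OF k] by simp
  also have "M n = replicate_mset (spec_mult_last n k) (- of_nat n - 1)"
    unfolding M_def spec_mult_last_eq[OF k] by simp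
  finally show ?thesis
    unfolding F_0 M_def by (simp only: add.assoc)
qed

end
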